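(* Let $f:X\to Y$ be a weakly $\kappa$-pseudo open map between Tychonoff spaces $X$ and $Y$. (i) If $X$ is weakly open-compact attainable, then so is $Y$. (ii) If $X$ is $\kappa$-sequential, then so is $Y$.
   Context: All topological spaces are assumed to be Tychonoff. A surjective continuous map $f:X\to Y$ is called weakly $\kappa$-pseudo open if an open set $U\subseteq Y$ is closed in $Y$ if and only if $f^{-1}(U)$ is closed in $X$. A space $X$ is weakly open-compact attainable if for every non-closed open $W\subseteq X$ there are a point $z\in\overline{W}\setminus W$ and a compact $K\subseteq X$ such that $z\in K\cap\overline{K\cap W}$. A space $X$ is $\kappa$-sequential if for every non-closed open $W\subseteq X$ there are a point $z\in\overline{W}\setminus W$ and a sequence $\{x_n\}_{n\in\omega}\subseteq W$ converging to $z$. *)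

theory Defs
  imports "HOL-Analysis.Analysis"
begin

definition Tychonoff_space :: "'a topology \<Rightarrow> bool" where
  "Tychonoff_space X \<longleftrightarrow> t1_space X \<and> completely_regular_space X"

definition weakly_kappa_pseudo_open_map ::
  "'a topology \<Rightarrow> 'b topology \<Rightarrow> ('a \<Rightarrow> 'b) \<Rightarrow> bool" where
  "weakly_kappa_pseudo_open_map X Y f \<longleftrightarrow>
     continuous_map X Y f \<and> f ` topspace X = topspace Y \<and>
     (\<forall>U. openin Y U \<longrightarrow> (closedin Y U \<longleftrightarrow> closedin X {x \<in> topspace X. f x \<in> U}))"

definition weakly_open_compact_attainable :: "'a topology \<Rightarrow> bool" where
  "weakly_open_compact_attainable X \<longleftrightarrow>
     (\<forall>W. openin X W \<and> \<not> closedin X W \<longrightarrow>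
        (\<exists>z K. z \<in> X closure_of W - W \<and> compactin X K \<and> z \<in> K \<inter> X closure_of (K \<inter> W)))"

definition kappa_sequential_space :: "'a topology \<Rightarrow> bool" where
  "kappa_sequential_space X \<longleftrightarrow>
     (\<forall>W. openin X W \<and> \<not> closedin X W \<longrightarrow>
        (\<exists>z \<in> X closure_of W - W. \<exists>x :: nat \<Rightarrow> 'a.
           range x \<subseteq> W \<and> limitin X x z sequentially))"

end

theory Submission
  imports Defs
begin

text \<open>Both properties ask that every open non-closed set have a witness of its non-closedness:
  a missing closure point approached within a compact set, or by a sequence. Given such a
  \<open>W\<close> in \<open>Y\<close>, pull it back to \<open>V\<close>, which is open by
  continuity and not closed by weak \<kappa>-pseudo openness. A witness for \<open>V\<close> exists
  in \<open>X\<close>, and its image under \<open>f\<close> is a witness for \<open>W\<close>, since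
  continuous maps preserve closure points, compactness and limits. The part common to both
  properties is this first lemma.\<close>

lemma weakly_kappa_pseudo_open_map_preimage:
  assumes f: "weakly_kappa_pseudo_open_map X Y f"
    and W: "openin Y W" "\<not> closedin Y W"
  defines "V \<equiv> {x \<in> topspace X. f x \<in> W}"
  shows "openin X V" "\<not> closedin X V"
    and "\<And>z. z \<in> X closure_of V - V \<Longrightarrow> f z \<in> Y closure_of W - W"
proof -
  have cont: "continuous_map X Y f"
    using f by (simp add: weakly_kappa_pseudo_open_map_def)
  show "openin X V"
    unfolding V_def using cont W(1) by (rule openin_continuous_map_preimage)
  \<comment> \<open>Here the closedness equivalence enters: \<open>W\<close> is open, so a closed
    preimage would force \<open>W\<close> to be closed.\<close>
  show "\<not> closedin X V"
    using f W by (auto simp: weakly_kappa_pseudo_open_map_def V_def)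
  fix z assume z: "z \<in> X closure_of V - V"
  have "f z \<in> Y closure_of (f ` V)"
    using continuous_map_image_closure_subset[OF cont] z by blast
  moreover have "f ` V \<subseteq> W"
    by (auto simp: V_def)
  ultimately have "f z \<in> Y closure_of W"
    using closure_of_mono by blast
  \<comment> \<open>\<open>V\<close> contains only points of the carrier, so
    \<open>z \<notin> V\<close> gives \<open>f z \<notin> W\<close> only once \<open>z\<close> is
    known to lie in \<open>topspace X\<close>.\<close>
  moreover have "z \<in> topspace X"
    using z closure_of_subset_topspace by fastforce
  ultimately show "f z \<in> Y closure_of W - W"
    using z by (auto simp: V_def)
qed

lemma weakly_open_compact_attainable_image:
  assumes f: "weakly_kappa_pseudo_open_map X Y f"
    and X: "weakly_open_compact_attainable X"
  shows "weakly_open_compact_attainable Y"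
  unfolding weakly_open_compact_attainable_def
proof (intro allI impI, elim conjE)
  fix W assume W: "openin Y W" "\<not> closedin Y W"
  have cont: "continuous_map X Y f"
    using f by (simp add: weakly_kappa_pseudo_open_map_def)
  define V where "V = {x \<in> topspace X. f x \<in> W}"
  note V = weakly_kappa_pseudo_open_map_preimage[OF f W, folded V_def]
  obtain z K where z: "z \<in> X closure_of V - V" and K: "compactin X K"
    and zK: "z \<in> K" "z \<in> X closure_of (K \<inter> V)"
    using X V(1,2) unfolding weakly_open_compact_attainable_def by blast
  have "f z \<in> Y closure_of (f ` (K \<inter> V))"
    using continuous_map_image_closure_subset[OF cont] zK(2) by blast
  \<comment> \<open>An inclusion suffices, because closure is monotone.\<close>
  moreover have "f ` (K \<inter> V) \<subseteq> f ` K \<inter> W"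
    by (auto simp: V_def)
  ultimately have "f z \<in> f ` K \<inter> Y closure_of (f ` K \<inter> W)"
    using closure_of_mono zK(1) by blast
  then show "\<exists>z K. z \<in> Y closure_of W - W \<and> compactin Y K \<and> z \<in> K \<inter> Y closure_of (K \<inter> W)"
    using V(3)[OF z] image_compactin[OF K cont] by blast
qed

text \<open>Same transfer, with the image sequence \<open>f \<circ> x\<close>: it stays in
  \<open>W\<close> because \<open>x\<close> stays in the preimage, and it tends to
  \<open>f z\<close> by continuity.\<close>

lemma kappa_sequential_space_image:
  assumes f: "weakly_kappa_pseudo_open_map X Y f"
    and X: "kappa_sequential_space X"
  shows "kappa_sequential_space Y"
  unfolding kappa_sequential_space_def
proof (intro allI impI, elim conjE)
  fix W assume W: "openin Y W" "\<not> closedin Y W"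
  have cont: "continuous_map X Y f"
    using f by (simp add: weakly_kappa_pseudo_open_map_def)
  define V where "V = {x \<in> topspace X. f x \<in> W}"
  note V = weakly_kappa_pseudo_open_map_preimage[OF f W, folded V_def]
  obtain z and x :: "nat \<Rightarrow> 'a" where z: "z \<in> X closure_of V - V"
    and x: "range x \<subseteq> V" "limitin X x z sequentially"
    using X V(1,2) unfolding kappa_sequential_space_def by blast
  have "limitin Y (f \<circ> x) (f z) sequentially"
    using cont x(2) by (rule continuous_map_limit)
  moreover have "range (f \<circ> x) \<subseteq> W"
    using x(1) by (auto simp: V_def)
  ultimately show "\<exists>z \<in> Y closure_of W - W. \<exists>x :: nat \<Rightarrow> 'b.
      range x \<subseteq> W \<and> limitin Y x z sequentially"
    using V(3)[OF z] by blast
qed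

theorem proposition4p7:
  fixes X :: "'a topology" and Y :: "'b topology" and f :: "'a \<Rightarrow> 'b"
  assumes "Tychonoff_space X"
    and "Tychonoff_space Y"
    and "weakly_kappa_pseudo_open_map X Y f"
  shows "(weakly_open_compact_attainable X \<longrightarrow> weakly_open_compact_attainable Y) \<and>
         (kappa_sequential_space X \<longrightarrow> kappa_sequential_space Y)"
  using assms(3) weakly_open_compact_attainable_image kappa_sequential_space_image by blast

end
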